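(* Let $Y$ be a Banach space and let $A:\ell^1(\mathbb{N})\to Y$ be an injective bounded linear operator. The following are equivalent: (1) there are constants $\gamma_n>0$, $n\in\mathbb{N}$, such that the Source Assumption (defined in the context) holds for $A$ with $\mathcal{M}_n=\{\{1,\ldots,n\}\}$ for all $n\in\mathbb{N}$, with these $\gamma_n$, and with $c=0$; (2) for every $k\in\mathbb{N}$ there is some $f^{(k)}\in Y^\ast$ with $e^{(k)}=A^\ast f^{(k)}$. Moreover, if $f^{(k)}$, $k\in\mathbb{N}$, are as in (2), then the constants in (1) can be chosen as $\gamma_n=\sum_{k=1}^n\|f^{(k)}\|_{Y^\ast}$.
   Context: Sequences are real and indexed by $\mathbb{N}=\{1,2,\ldots\}$. $e^{(k)}=(0,\ldots,0,1,0,\ldots)$ is the sequence with $1$ at position $k$ and zeros elsewhere. $A^\ast:Y^\ast\to\ell^\infty(\mathbb{N})$ is the adjoint of $A$, where $\ell^\infty(\mathbb{N})$ is identified with the dual of $\ell^1(\mathbb{N})$. For $M\subseteq\mathbb{N}$, $P_M$ denotes the projection (on $\ell^\infty(\mathbb{N})$ and on $\ell^1(\mathbb{N})$) given by $[P_M\xi]_k=\xi_k$ if $k\in M$ and $[P_M\xi]_k=0$ otherwise; $I$ is the identity. $\supp\xi=\{k\in\mathbb{N}:\xi_k\neq0\}$. Let $$\mathbf{1}_M:=\{\xi\in\ell^\infty(\mathbb{N}):\supp\xi\subseteq M\text{ and }\xi_k\in\{-1,0,1\}\text{ for all }k\in\mathbb{N}\}.$$ Source Assumption (for $A$, with $(\mathcal{M}_n)_{n\in\mathbb{N}}$,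 constants $\gamma_n>0$ and $c\in[0,1)$): for each $n\in\mathbb{N}$, $\mathcal{M}_n$ is a family of index sets $M\subseteq\mathbb{N}$ of cardinality $|M|=n$ with $\{1,\ldots,n\}\in\mathcal{M}_n$; and for each $n\in\mathbb{N}$ and each $\xi\in\bigcup_{M\in\mathcal{M}_n}\mathbf{1}_M$ there is some $\eta=\eta(n,\xi)\in Y^\ast$ such that (i) $\|\eta\|_{Y^\ast}\leq\gamma_n$ (with $\gamma_n$ independent of $\xi$); (ii) $P_{\supp\xi}A^\ast\eta=\xi$; (iii) $\|(I-P_{\supp\xi})A^\ast\eta\|_{\ell^\infty(\mathbb{N})}\leq c$ (with $c$ independent of $\xi$ and $n$). *)

theory Defs
  imports "HOL-Analysis.Analysis"
begin

text \<open>Sequences are indexed by $\{1,2,\ldots\}$; they are represented by functions on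
  \<^typ>\<open>nat\<close> that vanish at the unused index 0.\<close>

typedef ell1 = "{x :: nat \<Rightarrow> real. x 0 = 0 \<and> summable (\<lambda>k. \<bar>x k\<bar>)}"
  morphisms seq1 Abs_ell1
  by (rule exI[of _ "\<lambda>_. 0"]) simp

setup_lifting type_definition_ell1

typedef ellinf = "{x :: nat \<Rightarrow> real. x 0 = 0 \<and> bounded (range x)}"
  morphisms seqinf Abs_ellinf
  by (rule exI[of _ "\<lambda>_. 0"]) (simp add: image_constant_conv)

setup_lifting type_definition_ellinf

lemma seq1_0 [simp]: "seq1 x 0 = 0"
  using seq1[of x] by simp

lemma seq1_summable: "summable (\<lambda>k. \<bar>seq1 x k\<bar>)"
  using seq1[of x] by simp

lemma seqinf_0 [simp]: "seqinf x 0 = 0"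
  using seqinf[of x] by simp

lemma seqinf_bounded: "bounded (range (seqinf x))"
  using seqinf[of x] by simp

lemma bounded_range_abs_iff:
  fixes x :: "nat \<Rightarrow> real"
  shows "bounded (range x) \<longleftrightarrow> (\<exists>B. \<forall>k. \<bar>x k\<bar> \<le> B)"
  by (auto simp: bounded_iff)

instantiation ell1 :: real_normed_vector
begin

lift_definition zero_ell1 :: ell1 is "\<lambda>_. 0" by simp

lift_definition plus_ell1 :: "ell1 \<Rightarrow> ell1 \<Rightarrow> ell1" is "\<lambda>x y k. x k + y k"
proof -
  fix x y :: "nat \<Rightarrow> real"
  assume "x 0 = 0 \<and> summable (\<lambda>k. \<bar>x k\<bar>)" "y 0 = 0 \<and> summable (\<lambda>k. \<bar>y k\<bar>)"
  then show "x 0 + y 0 = 0 \<and> summable (\<lambda>k. \<bar>x k + y k\<bar>)"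
    using summable_comparison_test'[of "\<lambda>k. \<bar>x k\<bar> + \<bar>y k\<bar>" 0 "\<lambda>k. \<bar>x k + y k\<bar>"]
    by (simp add: summable_add abs_triangle_ineq)
qed

lift_definition minus_ell1 :: "ell1 \<Rightarrow> ell1 \<Rightarrow> ell1" is "\<lambda>x y k. x k - y k"
proof -
  fix x y :: "nat \<Rightarrow> real"
  assume "x 0 = 0 \<and> summable (\<lambda>k. \<bar>x k\<bar>)" "y 0 = 0 \<and> summable (\<lambda>k. \<bar>y k\<bar>)"
  then show "x 0 - y 0 = 0 \<and> summable (\<lambda>k. \<bar>x k - y k\<bar>)"
    using summable_comparison_test'[of "\<lambda>k. \<bar>x k\<bar> + \<bar>y k\<bar>" 0 "\<lambda>k. \<bar>x k - y k\<bar>"]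
    by (simp add: summable_add abs_triangle_ineq4)
qed

lift_definition uminus_ell1 :: "ell1 \<Rightarrow> ell1" is "\<lambda>x k. - x k" by simp

lift_definition scaleR_ell1 :: "real \<Rightarrow> ell1 \<Rightarrow> ell1" is "\<lambda>a x k. a * x k"
  by (auto simp: abs_mult intro: summable_mult)

lift_definition norm_ell1 :: "ell1 \<Rightarrow> real" is "\<lambda>x. \<Sum>k. \<bar>x k\<bar>" .

definition dist_ell1 :: "ell1 \<Rightarrow> ell1 \<Rightarrow> real" where
  "dist_ell1 x y = norm (x - y)"

definition sgn_ell1 :: "ell1 \<Rightarrow> ell1" where
  "sgn_ell1 x = inverse (norm x) *\<^sub>R x"

definition uniformity_ell1 :: "(ell1 \<times> ell1) filter" where
  "uniformity_ell1 = (INF e\<in>{0<..}. principal {(x, y). dist x y < e})"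

definition open_ell1 :: "ell1 set \<Rightarrow> bool" where
  "open_ell1 U = (\<forall>x\<in>U. \<forall>\<^sub>F (x', y) in uniformity. x' = x \<longrightarrow> y \<in> U)"

instance
proof
  fix x y z :: ell1 and a b :: real
  show "x + y + z = x + (y + z)" "x + y = y + x" "0 + x = x" "- x + x = 0" "x - y = x + - y"
    "a *\<^sub>R (x + y) = a *\<^sub>R x + a *\<^sub>R y" "(a + b) *\<^sub>R x = a *\<^sub>R x + b *\<^sub>R x"
    "a *\<^sub>R b *\<^sub>R x = (a * b) *\<^sub>R x" "1 *\<^sub>R x = x"
    by (transfer; auto simp: algebra_simps)+
  show "dist x y = norm (x - y)" by (rule dist_ell1_def)
  show "sgn x = inverse (norm x) *\<^sub>R x" by (rule sgn_ell1_def)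
  show "uniformity = (INF e\<in>{0<..}. principal {(x::ell1, y). dist x y < e})"
    by (rule uniformity_ell1_def)
  show "open U = (\<forall>x\<in>U. \<forall>\<^sub>F (x', y) in uniformity. x' = x \<longrightarrow> y \<in> U)" for U :: "ell1 set"
    by (rule open_ell1_def)
  show "norm x = 0 \<longleftrightarrow> x = 0"
  proof transfer
    fix x :: "nat \<Rightarrow> real"
    assume "x 0 = 0 \<and> summable (\<lambda>k. \<bar>x k\<bar>)"
    then show "(\<Sum>k. \<bar>x k\<bar>) = 0 \<longleftrightarrow> x = (\<lambda>_. 0)"
      using suminf_eq_zero_iff[of "\<lambda>k. \<bar>x k\<bar>"] by auto
  qed
  show "norm (x + y) \<le> norm x + norm y"
  proof -
    have "(\<Sum>k. \<bar>seq1 x k + seq1 y k\<bar>) \<le> (\<Sum>k. \<bar>seq1 x k\<bar> + \<bar>seq1 y k\<bar>)"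
      using seq1_summable[of "x + y"]
      by (intro suminf_le summable_add seq1_summable abs_triangle_ineq)
        (simp add: plus_ell1.rep_eq)
    then show ?thesis
      by (simp add: norm_ell1.rep_eq plus_ell1.rep_eq suminf_add[OF seq1_summable seq1_summable])
  qed
  show "norm (a *\<^sub>R x) = \<bar>a\<bar> * norm x"
    by transfer (simp add: abs_mult suminf_mult)
qed

end

instantiation ellinf :: real_normed_vector
begin

lift_definition zero_ellinf :: ellinf is "\<lambda>_. 0" by (simp add: image_constant_conv)

lift_definition plus_ellinf :: "ellinf \<Rightarrow> ellinf \<Rightarrow> ellinf" is "\<lambda>x y k. x k + y k"
proof -
  fix x y :: "nat \<Rightarrow> real"
  assume "x 0 = 0 \<and> bounded (range x)" "y 0 = 0 \<and> bounded (range y)"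
  then obtain B C where "x 0 = 0" "y 0 = 0" "\<And>k. \<bar>x k\<bar> \<le> B" "\<And>k. \<bar>y k\<bar> \<le> C"
    unfolding bounded_range_abs_iff by blast
  then have "\<bar>x k + y k\<bar> \<le> B + C" for k
    by (meson abs_triangle_ineq add_mono order_trans)
  then show "x 0 + y 0 = 0 \<and> bounded (range (\<lambda>k. x k + y k))"
    using \<open>x 0 = 0\<close> \<open>y 0 = 0\<close> unfolding bounded_range_abs_iff by auto
qed

lift_definition minus_ellinf :: "ellinf \<Rightarrow> ellinf \<Rightarrow> ellinf" is "\<lambda>x y k. x k - y k"
proof -
  fix x y :: "nat \<Rightarrow> real"
  assume "x 0 = 0 \<and> bounded (range x)" "y 0 = 0 \<and> bounded (range y)"
  then obtain B C where "x 0 = 0" "y 0 = 0" "\<And>k. \<bar>x k\<bar> \<le> B" "\<And>k. \<bar>y k\<bar> \<le> C"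
    unfolding bounded_range_abs_iff by blast
  then have "\<bar>x k - y k\<bar> \<le> B + C" for k
    by (meson abs_triangle_ineq4 add_mono order_trans)
  then show "x 0 - y 0 = 0 \<and> bounded (range (\<lambda>k. x k - y k))"
    using \<open>x 0 = 0\<close> \<open>y 0 = 0\<close> unfolding bounded_range_abs_iff by auto
qed

lift_definition uminus_ellinf :: "ellinf \<Rightarrow> ellinf" is "\<lambda>x k. - x k"
  unfolding bounded_range_abs_iff by auto

lift_definition scaleR_ellinf :: "real \<Rightarrow> ellinf \<Rightarrow> ellinf" is "\<lambda>a x k. a * x k"
proof -
  fix a :: real and x :: "nat \<Rightarrow> real"
  assume "x 0 = 0 \<and> bounded (range x)"
  then obtain B where "x 0 = 0" "\<And>k. \<bar>x k\<bar> \<le> B"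
    unfolding bounded_range_abs_iff by blast
  then have "\<bar>a * x k\<bar> \<le> \<bar>a\<bar> * B" for k
    by (simp add: abs_mult mult_left_mono)
  then show "a * x 0 = 0 \<and> bounded (range (\<lambda>k. a * x k))"
    using \<open>x 0 = 0\<close> unfolding bounded_range_abs_iff by auto
qed

lift_definition norm_ellinf :: "ellinf \<Rightarrow> real" is "\<lambda>x. SUP k. \<bar>x k\<bar>" .

definition dist_ellinf :: "ellinf \<Rightarrow> ellinf \<Rightarrow> real" where
  "dist_ellinf x y = norm (x - y)"

definition sgn_ellinf :: "ellinf \<Rightarrow> ellinf" where
  "sgn_ellinf x = inverse (norm x) *\<^sub>R x"

definition uniformity_ellinf :: "(ellinf \<times> ellinf) filter" where
  "uniformity_ellinf = (INF e\<in>{0<..}. principal {(x, y). dist x y < e})"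

definition open_ellinf :: "ellinf set \<Rightarrow> bool" where
  "open_ellinf U = (\<forall>x\<in>U. \<forall>\<^sub>F (x', y) in uniformity. x' = x \<longrightarrow> y \<in> U)"

lemma abs_le_norm_ellinf: "\<bar>seqinf x k\<bar> \<le> norm x"
proof -
  have "bdd_above (range (\<lambda>k. \<bar>seqinf x k\<bar>))"
    using seqinf_bounded[of x] unfolding bounded_range_abs_iff bdd_above_def by auto
  then show ?thesis by (auto simp: norm_ellinf.rep_eq intro: cSUP_upper)
qed

lemma norm_ellinf_le: "(\<And>k. \<bar>seqinf x k\<bar> \<le> B) \<Longrightarrow> norm x \<le> B"
  by (auto simp: norm_ellinf.rep_eq intro: cSUP_least)

instance
proof
  fix x y z :: ellinf and a b :: real
  show "x + y + z = x + (y + z)" "x + y = y + x" "0 + x = x" "- x + x = 0" "x - y = x + - y"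
    "a *\<^sub>R (x + y) = a *\<^sub>R x + a *\<^sub>R y" "(a + b) *\<^sub>R x = a *\<^sub>R x + b *\<^sub>R x"
    "a *\<^sub>R b *\<^sub>R x = (a * b) *\<^sub>R x" "1 *\<^sub>R x = x"
    by (transfer; auto simp: algebra_simps)+
  show "dist x y = norm (x - y)" by (rule dist_ellinf_def)
  show "sgn x = inverse (norm x) *\<^sub>R x" by (rule sgn_ellinf_def)
  show "uniformity = (INF e\<in>{0<..}. principal {(x::ellinf, y). dist x y < e})"
    by (rule uniformity_ellinf_def)
  show "open U = (\<forall>x\<in>U. \<forall>\<^sub>F (x', y) in uniformity. x' = x \<longrightarrow> y \<in> U)" for U :: "ellinf set"
    by (rule open_ellinf_def)
  show "norm x = 0 \<longleftrightarrow> x = 0"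
  proof
    assume "norm x = 0"
    then have "seqinf x k = 0" for k using abs_le_norm_ellinf[of x k] by simp
    then show "x = 0" by (auto simp: seqinf_inject[symmetric] zero_ellinf.rep_eq)
  qed (simp add: norm_ellinf.rep_eq zero_ellinf.rep_eq)
  show "norm (x + y) \<le> norm x + norm y"
    by (rule norm_ellinf_le)
      (auto simp: plus_ellinf.rep_eq
        intro!: order_trans[OF abs_triangle_ineq] add_mono abs_le_norm_ellinf)
  have le: "norm (a *\<^sub>R x) \<le> \<bar>a\<bar> * norm x" for a and x :: ellinf
    by (rule norm_ellinf_le)
      (auto simp: scaleR_ellinf.rep_eq abs_mult intro!: mult_left_mono abs_le_norm_ellinf)
  show "norm (a *\<^sub>R x) = \<bar>a\<bar> * norm x"
  proof (cases "a = 0")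
    case True
    have "0 \<le> norm (a *\<^sub>R x)" using abs_le_norm_ellinf[of "a *\<^sub>R x" 0] by simp
    then show ?thesis using le[of a x] True by simp
  next
    case False
    have "inverse a *\<^sub>R a *\<^sub>R x = x"
      using False by (auto simp: seqinf_inject[symmetric] scaleR_ellinf.rep_eq)
    then have "norm x \<le> \<bar>inverse a\<bar> * norm (a *\<^sub>R x)"
      using le[of "inverse a" "a *\<^sub>R x"] by simp
    then have "\<bar>a\<bar> * norm x \<le> norm (a *\<^sub>R x)"
      using False by (simp add: field_simps)
    then show ?thesis using le[of a x] by simp
  qed
qed

end

text \<open>Unit sequences; only $k \geq 1$ is meaningful (for $k = 0$ they are the zero sequence).\<close>

lift_definition unit1 :: "nat \<Rightarrow> ell1" is "\<lambda>k j. if j = k \<and> k \<ge> 1 then 1 else 0"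
proof -
  fix k :: nat
  show "(if 0 = k \<and> k \<ge> 1 then 1 else 0::real) = 0 \<and>
      summable (\<lambda>j. \<bar>if j = k \<and> k \<ge> 1 then 1 else 0::real\<bar>)"
    by (auto intro!: summable_finite[of "{k}"])
qed

lift_definition unitinf :: "nat \<Rightarrow> ellinf" is "\<lambda>k j. if j = k \<and> k \<ge> 1 then 1 else 0"
  unfolding bounded_range_abs_iff by (auto intro!: exI[of _ 1])

lift_definition proj :: "nat set \<Rightarrow> ellinf \<Rightarrow> ellinf" is "\<lambda>M x k. if k \<in> M then x k else 0"
proof -
  fix M and x :: "nat \<Rightarrow> real"
  assume "x 0 = 0 \<and> bounded (range x)"
  then show "(if 0 \<in> M then x 0 else 0) = 0 \<and> bounded (range (\<lambda>k. if k \<in> M then x k else 0))"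
    using bounded_subset[of "insert 0 (range x)" "range (\<lambda>k. if k \<in> M then x k else 0)"]
    by (simp add: image_subset_iff)
qed

definition seq_supp :: "ellinf \<Rightarrow> nat set" where
  "seq_supp \<xi> = {k. k \<ge> 1 \<and> seqinf \<xi> k \<noteq> 0}"

definition sign_seqs :: "nat set \<Rightarrow> ellinf set" where
  "sign_seqs M = {\<xi>. seq_supp \<xi> \<subseteq> M \<and> (\<forall>k\<ge>1. seqinf \<xi> k \<in> {-1, 0, 1})}"

text \<open>The identification of $\ell^\infty$ with the dual of $\ell^1$ through the pairing
  $\langle \xi, x\rangle = \sum_k \xi_k x_k$.\<close>

definition ellinf_dual :: "ellinf \<Rightarrow> (ell1 \<Rightarrow>\<^sub>L real)" where
  "ellinf_dual \<xi> = Blinfun (\<lambda>x. \<Sum>k. seqinf \<xi> k * seq1 x k)"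

lemma pairing_abs_summable: "summable (\<lambda>k. \<bar>seqinf \<xi> k * seq1 x k\<bar>)"
  by (rule summable_comparison_test'[OF summable_mult[OF seq1_summable[of x], of "norm \<xi>"], of 0])
    (auto simp: abs_mult intro!: mult_right_mono abs_le_norm_ellinf)

lemma pairing_summable: "summable (\<lambda>k. seqinf \<xi> k * seq1 x k)"
  using pairing_abs_summable by (rule summable_rabs_cancel)

lemma pairing_le: "\<bar>\<Sum>k. seqinf \<xi> k * seq1 x k\<bar> \<le> norm \<xi> * norm x"
proof -
  have "\<bar>\<Sum>k. seqinf \<xi> k * seq1 x k\<bar> \<le> (\<Sum>k. \<bar>seqinf \<xi> k * seq1 x k\<bar>)"
    by (rule summable_rabs[OF pairing_abs_summable])
  also have "\<dots> \<le> (\<Sum>k. norm \<xi> * \<bar>seq1 x k\<bar>)"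
    by (intro suminf_le pairing_abs_summable summable_mult seq1_summable)
      (auto simp: abs_mult intro!: mult_right_mono abs_le_norm_ellinf)
  also have "\<dots> = norm \<xi> * norm x"
    by (simp add: norm_ell1.rep_eq suminf_mult[OF seq1_summable])
  finally show ?thesis .
qed

lemma ellinf_dual_apply: "blinfun_apply (ellinf_dual \<xi>) x = (\<Sum>k. seqinf \<xi> k * seq1 x k)"
proof -
  have "bounded_linear (\<lambda>x. \<Sum>k. seqinf \<xi> k * seq1 x k)"
  proof (rule bounded_linear_intro)
    fix x y and r :: real
    show "(\<Sum>k. seqinf \<xi> k * seq1 (x + y) k)
        = (\<Sum>k. seqinf \<xi> k * seq1 x k) + (\<Sum>k. seqinf \<xi> k * seq1 y k)"
      by (simp add: plus_ell1.rep_eq distrib_left suminf_add[OF pairing_summable pairing_summable])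
    show "(\<Sum>k. seqinf \<xi> k * seq1 (r *\<^sub>R x) k) = r *\<^sub>R (\<Sum>k. seqinf \<xi> k * seq1 x k)"
      using suminf_mult[OF pairing_summable[of \<xi> x], of r]
      by (simp add: scaleR_ell1.rep_eq mult.left_commute)
    show "norm (\<Sum>k. seqinf \<xi> k * seq1 x k) \<le> norm x * norm \<xi>"
      using pairing_le[of \<xi> x] by (simp add: mult.commute)
  qed
  then show ?thesis by (simp add: ellinf_dual_def bounded_linear_Blinfun_apply)
qed

lemma norm_unit1_le: "norm (unit1 k) \<le> 1"
proof -
  have "(\<Sum>j. \<bar>if j = k \<and> k \<ge> 1 then 1 else 0::real\<bar>)
      = (\<Sum>j\<in>{k}. \<bar>if j = k \<and> k \<ge> 1 then 1 else 0\<bar>)"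
    by (rule suminf_finite) auto
  then show ?thesis by (simp add: norm_ell1.rep_eq unit1.rep_eq)
qed

lemma ellinf_dual_unit1: "blinfun_apply (ellinf_dual \<xi>) (unit1 k) = seqinf \<xi> k"
proof -
  have "(\<Sum>j. seqinf \<xi> j * seq1 (unit1 k) j) = (\<Sum>j\<in>{k}. seqinf \<xi> j * seq1 (unit1 k) j)"
    by (rule suminf_finite) (auto simp: unit1.rep_eq)
  then show ?thesis by (cases k) (auto simp: ellinf_dual_apply unit1.rep_eq)
qed

lemma norm_ellinf_dual: "norm (ellinf_dual \<xi>) = norm \<xi>"
proof (rule antisym)
  show "norm (ellinf_dual \<xi>) \<le> norm \<xi>"
    by (rule norm_blinfun_bound) (auto simp: ellinf_dual_apply pairing_le)
  show "norm \<xi> \<le> norm (ellinf_dual \<xi>)"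
  proof (rule norm_ellinf_le)
    fix k
    have "\<bar>seqinf \<xi> k\<bar> \<le> norm (ellinf_dual \<xi>) * norm (unit1 k)"
      using norm_blinfun[of "ellinf_dual \<xi>" "unit1 k"] by (simp add: ellinf_dual_unit1)
    also have "\<dots> \<le> norm (ellinf_dual \<xi>) * 1"
      by (intro mult_left_mono norm_unit1_le) simp
    finally show "\<bar>seqinf \<xi> k\<bar> \<le> norm (ellinf_dual \<xi>)" by simp
  qed
qed

lemma linear_ellinf_dual: "linear ellinf_dual"
proof (rule linearI)
  fix \<xi> \<zeta> and r :: real
  show "ellinf_dual (\<xi> + \<zeta>) = ellinf_dual \<xi> + ellinf_dual \<zeta>"
    by (rule blinfun_eqI)
      (simp add: ellinf_dual_apply plus_ellinf.rep_eq blinfun.add_left distrib_right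
        suminf_add[OF pairing_summable pairing_summable])
  show "ellinf_dual (r *\<^sub>R \<xi>) = r *\<^sub>R ellinf_dual \<xi>"
    by (rule blinfun_eqI)
      (simp add: ellinf_dual_apply scaleR_ellinf.rep_eq blinfun.scaleR_left mult.assoc
        suminf_mult[OF pairing_summable])
qed

lemma seq1_sum: "seq1 (sum g S) j = (\<Sum>k\<in>S. seq1 (g k) j)"
  by (induction S rule: infinite_finite_induct) (auto simp: zero_ell1.rep_eq plus_ell1.rep_eq)

lemma unit1_expansion: "(\<lambda>k. seq1 x k *\<^sub>R unit1 k) sums x"
proof -
  define T where "T n = (\<Sum>k<n. seq1 x k *\<^sub>R unit1 k)" for n
  have T: "seq1 (T n) j = (if j < n then seq1 x j else 0)" for n j
  proof -
    have "seq1 (T n) j = (\<Sum>k<n. if k = j then seq1 x j else 0)"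
      unfolding T_def seq1_sum
      by (intro sum.cong) (auto simp: scaleR_ell1.rep_eq unit1.rep_eq not_less_eq_eq)
    then show ?thesis by simp
  qed
  have "norm (T n - x) = (\<Sum>k. \<bar>seq1 x k\<bar>) - (\<Sum>k<n. \<bar>seq1 x k\<bar>)" for n
  proof -
    have "(\<lambda>j. if j < n then \<bar>seq1 x j\<bar> else 0) sums (\<Sum>j | j < n. \<bar>seq1 x j\<bar>)"
      by (rule sums_If_finite) simp
    from sums_diff[OF summable_sums[OF seq1_summable[of x]] this]
    have "(\<lambda>j. \<bar>seq1 (T n - x) j\<bar>) sums ((\<Sum>k. \<bar>seq1 x k\<bar>) - (\<Sum>k<n. \<bar>seq1 x k\<bar>))"
      by (rule iffD1[OF sums_cong, THEN back_subst[of "\<lambda>c. _ sums c"], rotated])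
        (auto simp: minus_ell1.rep_eq T lessThan_def)
    then show ?thesis by (simp add: norm_ell1.rep_eq sums_iff)
  qed
  moreover have "(\<lambda>n. (\<Sum>k. \<bar>seq1 x k\<bar>) - (\<Sum>k<n. \<bar>seq1 x k\<bar>)) \<longlonglongrightarrow> 0"
    using tendsto_diff[OF tendsto_const summable_LIMSEQ[OF seq1_summable[of x]],
      of "\<Sum>k. \<bar>seq1 x k\<bar>"] by simp
  ultimately have "(\<lambda>n. norm (T n - x)) \<longlonglongrightarrow> 0" by simp
  then show ?thesis
    by (simp add: sums_def T_def[symmetric] tendsto_norm_zero_iff LIM_zero_iff)
qed

lemma bij_ellinf_dual: "bij ellinf_dual"
proof (rule bijI)
  show "inj ellinf_dual"
  proof (rule injI)
    fix \<xi> \<zeta> assume "ellinf_dual \<xi> = ellinf_dual \<zeta>"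
    then have "seqinf \<xi> k = seqinf \<zeta> k" for k by (simp flip: ellinf_dual_unit1)
    then show "\<xi> = \<zeta>" by (simp add: fun_eq_iff flip: seqinf_inject)
  qed
  show "surj ellinf_dual"
  proof (rule surjI)
    fix \<phi> :: "ell1 \<Rightarrow>\<^sub>L real"
    define z where "z k = blinfun_apply \<phi> (unit1 k)" for k
    have "\<bar>z k\<bar> \<le> norm \<phi>" for k
      using norm_blinfun[of \<phi> "unit1 k"] mult_left_mono[OF norm_unit1_le[of k], of "norm \<phi>"]
      by (simp add: z_def)
    moreover have "unit1 0 = 0" by transfer auto
    then have "z 0 = 0" by (simp add: z_def blinfun.zero_right)
    ultimately have z: "seqinf (Abs_ellinf z) = z"
      by (intro Abs_ellinf_inverse) (auto simp: bounded_range_abs_iff)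
    have "blinfun_apply (ellinf_dual (Abs_ellinf z)) x = blinfun_apply \<phi> x" for x
    proof -
      have "(\<lambda>k. blinfun_apply \<phi> (seq1 x k *\<^sub>R unit1 k)) sums blinfun_apply \<phi> x"
        by (rule bounded_linear.sums[OF blinfun.bounded_linear_right unit1_expansion])
      then show ?thesis
        by (simp add: ellinf_dual_apply z blinfun.scaleR_right z_def[symmetric] mult.commute sums_iff)
    qed
    then show "ellinf_dual (Abs_ellinf (\<lambda>k. blinfun_apply \<phi> (unit1 k))) = \<phi>"
      by (intro blinfun_eqI) (simp add: z_def[abs_def])
  qed
qed

definition dual_adjoint ::
    "(ell1 \<Rightarrow>\<^sub>L 'y::real_normed_vector) \<Rightarrow> ('y \<Rightarrow>\<^sub>L real) \<Rightarrow> ellinf" where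
  "dual_adjoint A \<eta> = inv ellinf_dual (\<eta> o\<^sub>L A)"

lemma ellinf_dual_dual_adjoint: "ellinf_dual (dual_adjoint A \<eta>) = \<eta> o\<^sub>L A"
  unfolding dual_adjoint_def by (rule surj_f_inv_f[OF bij_is_surj[OF bij_ellinf_dual]])

lemma seqinf_dual_adjoint:
  "seqinf (dual_adjoint A \<eta>) k = blinfun_apply \<eta> (blinfun_apply A (unit1 k))"
  using ellinf_dual_unit1[of "dual_adjoint A \<eta>" k] by (simp add: ellinf_dual_dual_adjoint)

definition source_assumption ::
    "(ell1 \<Rightarrow>\<^sub>L 'y::banach) \<Rightarrow> (nat \<Rightarrow> nat set set) \<Rightarrow> (nat \<Rightarrow> real) \<Rightarrow> real \<Rightarrow> bool" where
  "source_assumption A \<M> \<gamma> c \<longleftrightarrow>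
     (\<forall>n\<ge>1. \<gamma> n > 0) \<and> 0 \<le> c \<and> c < 1 \<and>
     (\<forall>n\<ge>1. (\<forall>M\<in>\<M> n. M \<subseteq> {1..} \<and> finite M \<and> card M = n) \<and> {1..n} \<in> \<M> n) \<and>
     (\<forall>n\<ge>1. \<forall>\<xi>\<in>(\<Union>M\<in>\<M> n. sign_seqs M). \<exists>\<eta> :: 'y \<Rightarrow>\<^sub>L real.
        norm \<eta> \<le> \<gamma> n \<and>
        proj (seq_supp \<xi>) (dual_adjoint A \<eta>) = \<xi> \<and>
        norm (dual_adjoint A \<eta> - proj (seq_supp \<xi>) (dual_adjoint A \<eta>)) \<le> c)"

end

theory Submission imports Defs begin

text \<open>For $c = 0$ conditions (ii) and (iii) collapse to $A^\ast\eta = \xi$. Hence (1) applied to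
  $\xi = e^{(k)}$ gives (2), and conversely $\eta = \sum_{k\le n} \xi_k f^{(k)}$ is a source
  element for $\xi$, of norm at most $\sum_{k\le n} \|f^{(k)}\|$ because $|\xi_k| \le 1$.\<close>

lemma proj_seq_supp_self: "proj (seq_supp \<xi>) \<xi> = \<xi>"
proof -
  have "seqinf (proj (seq_supp \<xi>) \<xi>) k = seqinf \<xi> k" for k
    \<comment> \<open>\<open>seq_supp\<close> leaves out the index 0, where every element of
      \<open>ellinf\<close> vanishes.\<close>
    by (cases "k = 0") (auto simp: proj.rep_eq seq_supp_def)
  then show ?thesis
    by (simp add: fun_eq_iff flip: seqinf_inject)
qed

text \<open>A norm bounded by 0 forces \<open>dual_adjoint A \<eta>\<close> to equal its own
  projection, which is \<open>\<xi>\<close>; conversely \<open>\<xi>\<close> is fixed by the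
  projection onto its support.\<close>

lemma source_assumption_initial_zero_iff:
  fixes A :: "ell1 \<Rightarrow>\<^sub>L 'y::banach"
  shows "source_assumption A (\<lambda>n. {{1..n}}) \<gamma> 0 \<longleftrightarrow>
    (\<forall>n\<ge>1. \<gamma> n > 0 \<and>
      (\<forall>\<xi>\<in>sign_seqs {1..n}. \<exists>\<eta> :: 'y \<Rightarrow>\<^sub>L real. norm \<eta> \<le> \<gamma> n \<and> dual_adjoint A \<eta> = \<xi>))"
proof -
  have "proj (seq_supp \<xi>) \<zeta> = \<xi> \<and> norm (\<zeta> - proj (seq_supp \<xi>) \<zeta>) \<le> 0 \<longleftrightarrow> \<zeta> = \<xi>" for \<xi> \<zeta>
    using proj_seq_supp_self by auto
  then show ?thesis
    unfolding source_assumption_def by auto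
qed

lemma unitinf_in_sign_seqs: "k \<in> M \<Longrightarrow> unitinf k \<in> sign_seqs M"
  by (auto simp: sign_seqs_def seq_supp_def unitinf.rep_eq split: if_splits)

lemma sign_seqs_abs_le_1: "\<xi> \<in> sign_seqs M \<Longrightarrow> \<bar>seqinf \<xi> k\<bar> \<le> 1"
proof (cases "k = 0")
  case False
  assume "\<xi> \<in> sign_seqs M"
  with False have "seqinf \<xi> k \<in> {-1, 0, 1}"
    by (simp add: sign_seqs_def)
  then show ?thesis by auto
qed simp

text \<open>The j-th entry of \<open>dual_adjoint A \<eta>\<close> is \<eta> evaluated at the image
  of the j-th unit sequence, hence linear in \<eta>. So the weighted sum of the \<open>f k\<close>
  is mapped to the same weighted sum of unit sequences.\<close>

lemma dual_adjoint_sum_scaleR: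
  assumes "\<xi> \<in> sign_seqs {1..n}" and f: "\<And>k. k \<ge> 1 \<Longrightarrow> dual_adjoint A (f k) = unitinf k"
  shows "dual_adjoint A (\<Sum>k=1..n. seqinf \<xi> k *\<^sub>R f k) = \<xi>"
proof -
  have "seqinf (dual_adjoint A (\<Sum>k=1..n. seqinf \<xi> k *\<^sub>R f k)) j = seqinf \<xi> j" for j
  proof -
    have "seqinf (dual_adjoint A (\<Sum>k=1..n. seqinf \<xi> k *\<^sub>R f k)) j
        = (\<Sum>k=1..n. seqinf \<xi> k * seqinf (dual_adjoint A (f k)) j)"
      by (simp add: seqinf_dual_adjoint blinfun.sum_left blinfun.scaleR_left)
    also have "\<dots> = (\<Sum>k=1..n. if k = j then seqinf \<xi> j else 0)"
      by (intro sum.cong) (auto simp: f unitinf.rep_eq)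
    also have "\<dots> = seqinf \<xi> j"
    \<comment> \<open>For j outside the range the sum is 0, and so is the entry of
      \<open>\<xi>\<close>, whose support lies in \<open>{1..n}\<close>.\<close>
    proof (cases "j \<in> {1..n}")
      case False
      then have "j \<notin> seq_supp \<xi>"
        using assms(1) unfolding sign_seqs_def by blast
      then have "seqinf \<xi> j = 0"
        by (cases "j = 0") (simp_all add: seq_supp_def)
      then show ?thesis by simp
    qed simp
    finally show ?thesis .
  qed
  then show ?thesis
    by (simp add: fun_eq_iff flip: seqinf_inject)
qed

lemma norm_sum_scaleR_sign_seqs_le:
  fixes f :: "nat \<Rightarrow> 'a::real_normed_vector"
  assumes "\<xi> \<in> sign_seqs M"
  shows "norm (\<Sum>k\<in>S. seqinf \<xi> k *\<^sub>R f k) \<le> (\<Sum>k\<in>S. norm (f k))"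
  by (rule sum_norm_le) (simp add: mult_left_le_one_le sign_seqs_abs_le_1[OF assms])

text \<open>Evaluating \<open>f\<close> at the image of the k-th unit sequence gives 1. This makes
  the constants in the source assumption strictly positive.\<close>

lemma dual_adjoint_unitinf_nonzero:
  assumes "k \<ge> 1" "dual_adjoint A f = unitinf k"
  shows "f \<noteq> 0"
  using seqinf_dual_adjoint[of A f k] assms by (auto simp: unitinf.rep_eq)

text \<open>Serves both the explicit choice of constants and the implication from (2) to
  (1).\<close>

lemma source_assumption_sum_norm:
  fixes A :: "ell1 \<Rightarrow>\<^sub>L 'y::banach" and f :: "nat \<Rightarrow> 'y \<Rightarrow>\<^sub>L real"
  assumes f: "\<And>k. k \<ge> 1 \<Longrightarrow> dual_adjoint A (f k) = unitinf k"
  shows "source_assumption A (\<lambda>n. {{1..n}}) (\<lambda>n. \<Sum>k=1..n. norm (f k)) 0"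
  unfolding source_assumption_initial_zero_iff
proof (intro allI impI conjI ballI exI)
  fix n :: nat
  assume "n \<ge> 1"
  then show "0 < (\<Sum>k=1..n. norm (f k))"
    by (intro sum_pos) (auto simp: dual_adjoint_unitinf_nonzero[OF _ f])
  fix \<xi>
  assume "\<xi> \<in> sign_seqs {1..n}"
  \<comment> \<open>The source element is the combination of the \<open>f k\<close> with the entries
    of \<open>\<xi>\<close> as coefficients.\<close>
  then show "dual_adjoint A (\<Sum>k=1..n. seqinf \<xi> k *\<^sub>R f k) = \<xi>"
    and "norm (\<Sum>k=1..n. seqinf \<xi> k *\<^sub>R f k) \<le> (\<Sum>k=1..n. norm (f k))"
    by (rule dual_adjoint_sum_scaleR[OF _ f], simp, rule norm_sum_scaleR_sign_seqs_le)
qed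

theorem proposition3p1:
  fixes A :: "ell1 \<Rightarrow>\<^sub>L 'y::banach"
  assumes "inj (blinfun_apply A)"
  shows "((\<exists>\<gamma>. source_assumption A (\<lambda>n. {{1..n}}) \<gamma> 0) \<longleftrightarrow>
           (\<forall>k\<ge>1. \<exists>f :: 'y \<Rightarrow>\<^sub>L real. unitinf k = dual_adjoint A f)) \<and>
         (\<forall>f :: nat \<Rightarrow> 'y \<Rightarrow>\<^sub>L real. (\<forall>k\<ge>1. unitinf k = dual_adjoint A (f k)) \<longrightarrow>
           source_assumption A (\<lambda>n. {{1..n}}) (\<lambda>n. \<Sum>k=1..n. norm (f k)) 0)"
proof (intro conjI iffI)
  assume "\<exists>\<gamma>. source_assumption A (\<lambda>n. {{1..n}}) \<gamma> 0"
  then obtain \<gamma> where "source_assumption A (\<lambda>n. {{1..n}}) \<gamma> 0" ..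
  \<comment> \<open>The choice n = k is the smallest index set \<open>{1..n}\<close> that contains
    the support of the k-th unit sequence.\<close>
  moreover have "unitinf k \<in> sign_seqs {1..k}" if "k \<ge> 1" for k
    using that by (simp add: unitinf_in_sign_seqs)
  ultimately show "\<forall>k\<ge>1. \<exists>f :: 'y \<Rightarrow>\<^sub>L real. unitinf k = dual_adjoint A f"
    unfolding source_assumption_initial_zero_iff by metis
next
  assume "\<forall>k\<ge>1. \<exists>f :: 'y \<Rightarrow>\<^sub>L real. unitinf k = dual_adjoint A f"
  \<comment> \<open>One functional is chosen for each k \<ge> 1; \<open>f 0\<close> stays arbitrary,
    and the sums start at 1.\<close>
  then obtain f :: "nat \<Rightarrow> 'y \<Rightarrow>\<^sub>L real" where "\<And>k. k \<ge> 1 \<Longrightarrow> dual_adjoint A (f k) = unitinf k"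
    by metis
  then show "\<exists>\<gamma>. source_assumption A (\<lambda>n. {{1..n}}) \<gamma> 0"
    using source_assumption_sum_norm by blast
next
  show "\<forall>f :: nat \<Rightarrow> 'y \<Rightarrow>\<^sub>L real. (\<forall>k\<ge>1. unitinf k = dual_adjoint A (f k)) \<longrightarrow>
      source_assumption A (\<lambda>n. {{1..n}}) (\<lambda>n. \<Sum>k=1..n. norm (f k)) 0"
    by (intro allI impI source_assumption_sum_norm) (rule sym, blast)
qed

end
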